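(* Let $\Sigma$ be a bilateral fan and $A$ its ray matrix, with columns $v_1,\dots,v_n$. Then: (1) for $1\le i\le n$, a vector $e=-q_i+\sum_{j\ne i}b_jq_j$ with all $b_j\in\mathbb Z_{\ge0}$ belongs to $\mathfrak R_i$ if and only if $-Ae\ge0$ (coordinate-wise); (2) for $n+1\le k\le m$, a vector $e\in M$ is a (detached) root in $\mathfrak R_k$ if and only if $e=q_i$ for some $1\le i\le n$ such that the column $v_i$ is the vector of length $m-n$ with a $1$ in the $(k-n)$-th coordinate and $0$'s elsewhere.
   Context: $N\cong\mathbb Z^n$ is a lattice, $M=\mathrm{Hom}(N,\mathbb Z)$, $\langle\cdot,\cdot\rangle$ is the pairing. $\Sigma$ is a complete fan in $N_{\mathbb Q}$ whose rays have primitive generators $p_1,\dots,p_m$. $\Sigma$ is bilateral: the rays are ordered so that $p_1,\dots,p_n$ is a basis of $N$ and $p_k=-\sum_{j=1}^n a_{kj}p_j$ with $a_{kj}\in\mathbb Z_{\ge0}$ for $n+1\le k\le m$. $q_1,\dots,q_n$ is the dual basis of $M$. The ray matrix $A$ is the $(m-n)\times n$ matrix whose rows are $(a_{k1},\dots,a_{kn})$, $k=n+1,\dots,m$. A vector $e\in M$ is identified with the column of its coordinates in the basis $q_1,\dots,q_n$ when forming $Ae$. Demazure roots: for $1\le i\le m$, $\mathfrak R_i=\{e\in M:\langle e,p_i\rangle=-1,\ \langle e,p_s\rangle\ge0\ \forall s\ne i\}$, and $\mathfrak R=\bigsqcup_{i=1}^m\mathfrak R_i$. Roots in $\bigsqcup_{k=n+1}^m\mathfrak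 R_k$ are called detached. *)

theory Defs
  imports Jordan_Normal_Form.Matrix
begin

subsection \<open>Lattices and their rationalisations\<close>

definition lattice_basis :: "(int \<Rightarrow> 'a \<Rightarrow> 'a) \<Rightarrow> nat \<Rightarrow> (nat \<Rightarrow> 'a::ab_group_add) \<Rightarrow> bool" where
  "lattice_basis scaleZ n p \<longleftrightarrow>
     inj_on p {1..n} \<and>
     \<not> Modules.module.dependent scaleZ (p ` {1..n}) \<and>
     Modules.module.span scaleZ (p ` {1..n}) = UNIV"

text \<open>The type \<open>'a\<close> is the lattice \<open>N\<close> of rank \<open>n\<close>, with its unique structure of
  a module over the integers. The type \<open>'v\<close> together with the embedding \<open>emb\<close> of \<open>N\<close> is
  \<open>N\<^bsub>\<rat>\<^esub>\<close>, i.e. the tensor product of \<open>N\<close> with the rationals: a rational vector space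
  containing \<open>N\<close> in which every vector has a positive multiple in \<open>N\<close>.\<close>

locale rational_lattice =
  Modules.module scaleZ + V: vector_space scaleQ
  for scaleZ :: "int \<Rightarrow> 'a::ab_group_add \<Rightarrow> 'a"
    and scaleQ :: "rat \<Rightarrow> 'v::ab_group_add \<Rightarrow> 'v" +
  fixes emb :: "'a \<Rightarrow> 'v" and n :: nat
  assumes rank: "\<exists>b. lattice_basis scaleZ n b"
    and emb_add: "emb (x + y) = emb x + emb y"
    and emb_inj: "inj emb"
    and emb_multiple: "\<exists>k>0. \<exists>x. scaleQ (of_nat k) v = emb x"

definition dual_lattice :: "(int \<Rightarrow> 'a \<Rightarrow> 'a) \<Rightarrow> ('a::ab_group_add \<Rightarrow> int) set" where
  "dual_lattice scaleZ = {e. Modules.module_hom scaleZ (*) e}"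

definition dual_basis ::
  "(int \<Rightarrow> 'a \<Rightarrow> 'a) \<Rightarrow> nat \<Rightarrow> (nat \<Rightarrow> 'a::ab_group_add) \<Rightarrow> (nat \<Rightarrow> 'a \<Rightarrow> int) \<Rightarrow> bool" where
  "dual_basis scaleZ n p q \<longleftrightarrow>
     (\<forall>i\<in>{1..n}. q i \<in> dual_lattice scaleZ \<and>
        (\<forall>j\<in>{1..n}. q i (p j) = (if i = j then 1 else 0)))"

definition primitive :: "(int \<Rightarrow> 'a \<Rightarrow> 'a) \<Rightarrow> 'a \<Rightarrow> bool" where
  "primitive scaleZ x \<longleftrightarrow> (\<forall>k y. x = scaleZ k y \<longrightarrow> k dvd 1)"


subsection \<open>Fans\<close>

definition cone_hull :: "(rat \<Rightarrow> 'v \<Rightarrow> 'v) \<Rightarrow> 'v::ab_group_add set \<Rightarrow> 'v set" where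
  "cone_hull scaleQ S = {\<Sum>v\<in>S. scaleQ (c v) v | c. \<forall>v\<in>S. 0 \<le> c v}"

text \<open>Since the scalars are rational, every finitely generated cone is a rational cone.\<close>

definition polyhedral_cone :: "(rat \<Rightarrow> 'v \<Rightarrow> 'v) \<Rightarrow> 'v::ab_group_add set \<Rightarrow> bool" where
  "polyhedral_cone scaleQ \<sigma> \<longleftrightarrow> (\<exists>S. finite S \<and> \<sigma> = cone_hull scaleQ S)"

definition strongly_convex :: "'v::ab_group_add set \<Rightarrow> bool" where
  "strongly_convex \<sigma> \<longleftrightarrow> \<sigma> \<inter> uminus ` \<sigma> = {0}"

definition cone_face :: "(rat \<Rightarrow> 'v \<Rightarrow> 'v) \<Rightarrow> 'v::ab_group_add set \<Rightarrow> 'v set \<Rightarrow> bool" where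
  "cone_face scaleQ \<tau> \<sigma> \<longleftrightarrow>
     (\<exists>u. Vector_Spaces.linear scaleQ (*) u \<and> (\<forall>x\<in>\<sigma>. 0 \<le> u x) \<and> \<tau> = {x\<in>\<sigma>. u x = 0})"

definition fan :: "(rat \<Rightarrow> 'v \<Rightarrow> 'v) \<Rightarrow> 'v::ab_group_add set set \<Rightarrow> bool" where
  "fan scaleQ \<Sigma> \<longleftrightarrow>
     finite \<Sigma> \<and>
     (\<forall>\<sigma>\<in>\<Sigma>. polyhedral_cone scaleQ \<sigma> \<and> strongly_convex \<sigma>) \<and>
     (\<forall>\<sigma>\<in>\<Sigma>. \<forall>\<tau>. cone_face scaleQ \<tau> \<sigma> \<longrightarrow> \<tau> \<in> \<Sigma>) \<and>
     (\<forall>\<sigma>\<in>\<Sigma>. \<forall>\<sigma>'\<in>\<Sigma>. cone_face scaleQ (\<sigma> \<inter> \<sigma>') \<sigma> \<and> cone_face scaleQ (\<sigma> \<inter> \<sigma>') \<sigma>')"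

definition complete_fan :: "(rat \<Rightarrow> 'v \<Rightarrow> 'v) \<Rightarrow> 'v::ab_group_add set set \<Rightarrow> bool" where
  "complete_fan scaleQ \<Sigma> \<longleftrightarrow> fan scaleQ \<Sigma> \<and> \<Union>\<Sigma> = UNIV"

definition rays :: "(rat \<Rightarrow> 'v \<Rightarrow> 'v) \<Rightarrow> 'v::ab_group_add set set \<Rightarrow> 'v set set" where
  "rays scaleQ \<Sigma> = {\<rho>\<in>\<Sigma>. vector_space.dim scaleQ \<rho> = 1}"

text \<open>\<open>p 1, \<dots>, p m\<close> lists the primitive generators of the rays, each ray once.\<close>

definition ray_generators ::
  "(int \<Rightarrow> 'a \<Rightarrow> 'a) \<Rightarrow> (rat \<Rightarrow> 'v \<Rightarrow> 'v) \<Rightarrow> ('a \<Rightarrow> 'v) \<Rightarrow> 'v::ab_group_add set set \<Rightarrow>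
     nat \<Rightarrow> (nat \<Rightarrow> 'a) \<Rightarrow> bool" where
  "ray_generators scaleZ scaleQ emb \<Sigma> m p \<longleftrightarrow>
     (\<forall>i\<in>{1..m}. primitive scaleZ (p i)) \<and>
     bij_betw (\<lambda>i. cone_hull scaleQ {emb (p i)}) {1..m} (rays scaleQ \<Sigma>)"

text \<open>The ordering \<open>p\<close> of the ray generators and the coefficients \<open>a\<close> (which \<open>p\<close>
  determines) are part of the data.\<close>

definition bilateral_fan ::
  "(int \<Rightarrow> 'a \<Rightarrow> 'a) \<Rightarrow> (rat \<Rightarrow> 'v \<Rightarrow> 'v) \<Rightarrow> ('a::ab_group_add \<Rightarrow> 'v) \<Rightarrow> nat \<Rightarrow>
     'v::ab_group_add set set \<Rightarrow> nat \<Rightarrow> (nat \<Rightarrow> 'a) \<Rightarrow> (nat \<Rightarrow> nat \<Rightarrow> int) \<Rightarrow> bool" where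
  "bilateral_fan scaleZ scaleQ emb n \<Sigma> m p a \<longleftrightarrow>
     complete_fan scaleQ \<Sigma> \<and>
     ray_generators scaleZ scaleQ emb \<Sigma> m p \<and>
     n \<le> m \<and>
     lattice_basis scaleZ n p \<and>
     (\<forall>k\<in>{n+1..m}. (\<forall>j\<in>{1..n}. 0 \<le> a k j) \<and>
        p k = - (\<Sum>j\<in>{1..n}. scaleZ (a k j) (p j)))"

text \<open>Vectors and matrices are indexed from 0, rays and basis elements from 1.\<close>

definition ray_matrix :: "nat \<Rightarrow> nat \<Rightarrow> (nat \<Rightarrow> nat \<Rightarrow> int) \<Rightarrow> int mat" where
  "ray_matrix n m a = mat (m - n) n (\<lambda>(r, c). a (n + 1 + r) (c + 1))"

definition dual_coords :: "nat \<Rightarrow> (nat \<Rightarrow> 'a \<Rightarrow> int) \<Rightarrow> ('a \<Rightarrow> int) \<Rightarrow> int vec" where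
  "dual_coords n q e =
     (THE c. c \<in> carrier_vec n \<and> e = (\<lambda>x. \<Sum>j\<in>{1..n}. c $ (j - 1) * q j x))"


subsection \<open>Demazure roots\<close>

definition demazure_roots ::
  "(int \<Rightarrow> 'a \<Rightarrow> 'a) \<Rightarrow> nat \<Rightarrow> (nat \<Rightarrow> 'a::ab_group_add) \<Rightarrow> nat \<Rightarrow> ('a \<Rightarrow> int) set" where
  "demazure_roots scaleZ m p i =
     {e \<in> dual_lattice scaleZ. e (p i) = -1 \<and> (\<forall>s\<in>{1..m} - {i}. 0 \<le> e (p s))}"

end

theory Submission
  imports Defs
begin

text \<open>Write \<open>e\<^sub>j\<close> for the value \<open>e (p j)\<close>, \<open>1 \<le> j \<le> n\<close>; these are the coordinates of \<open>e\<close> in the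
  dual basis. On the remaining rays \<open>e (p k) = - (\<Sum>j. a k j * e\<^sub>j)\<close>, so the entries of \<open>- A e\<close>
  are exactly the values of \<open>e\<close> on \<open>p (n + 1), \<dots>, p m\<close>. This gives part (1) at once.

  For part (2), let \<open>e\<close> be a root of the ray \<open>k > n\<close>. All \<open>e\<^sub>j\<close> are nonnegative, hence so are all
  the products \<open>a s j * e\<^sub>j\<close>. For \<open>s = k\<close> they add up to 1, so exactly one of them, at
  some \<open>i\<close>, is 1 and the others vanish; for \<open>s \<noteq> k\<close> their sum is at most 0, so they all vanish.
  Thus \<open>e\<^sub>i = 1\<close>, and column \<open>i\<close> is the required unit vector. It remains to see that \<open>e\<^sub>j = 0\<close> for
  \<open>j \<noteq> i\<close>. If not, column \<open>j\<close> of \<open>A\<close> vanishes, and then \<open>q j\<close> is nonnegative on all rays.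

  That is where completeness enters: a functional that is nonnegative on all rays of a complete
  fan is zero (\<open>functional_nonneg_on_rays_eq_0\<close>), because every vector is a nonnegative
  combination of ray generators (\<open>complete_fan_generated_by_rays\<close>). The latter says that a
  strongly convex cone is generated by its one-dimensional faces. Since faces are cut out by
  supporting functionals, this rests on the Farkas lemma (\<open>farkas\<close>): it turns the irredundance of
  a generator into a functional that exposes the ray through it
  (\<open>generator_spans_face\<close>).\<close>

section \<open>Finitely generated rational cones\<close>

locale rational_vector_space = vector_space scaleQ
  for scaleQ :: "rat \<Rightarrow> 'v::ab_group_add \<Rightarrow> 'v"
begin

text \<open>Generators are indexed by a family rather than collected in a set: the Farkas lemma projects
  the generators, and distinct generators may then coincide.\<close>

definition family_cone :: "'i set \<Rightarrow> ('i \<Rightarrow> 'v) \<Rightarrow> 'v set" where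
  "family_cone I f = {\<Sum>i\<in>I. scaleQ (c i) (f i) | c. \<forall>i\<in>I. 0 \<le> c i}"

lemma cone_hull_eq_family_cone: "cone_hull scaleQ S = family_cone S (\<lambda>v. v)"
  by (simp add: cone_hull_def family_cone_def)

lemma family_coneI: "\<forall>i\<in>I. 0 \<le> c i \<Longrightarrow> (\<Sum>i\<in>I. scaleQ (c i) (f i)) \<in> family_cone I f"
  unfolding family_cone_def by blast

lemma family_coneE:
  assumes "x \<in> family_cone I f"
  obtains c where "\<forall>i\<in>I. 0 \<le> c i" "x = (\<Sum>i\<in>I. scaleQ (c i) (f i))"
  using assms unfolding family_cone_def by blast

lemma family_cone_zero: "0 \<in> family_cone I f"
  using family_coneI[of I "\<lambda>_. 0" f] by simp

lemma family_cone_add: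
  assumes "x \<in> family_cone I f" "y \<in> family_cone I f"
  shows "x + y \<in> family_cone I f"
proof -
  obtain c d where "\<forall>i\<in>I. 0 \<le> c i" "x = (\<Sum>i\<in>I. scaleQ (c i) (f i))"
    and "\<forall>i\<in>I. 0 \<le> d i" "y = (\<Sum>i\<in>I. scaleQ (d i) (f i))"
    using assms by (elim family_coneE)
  then show ?thesis
    using family_coneI[of I "\<lambda>i. c i + d i" f] by (simp add: scale_left_distrib sum.distrib)
qed

lemma family_cone_scale:
  assumes "x \<in> family_cone I f" "0 \<le> r"
  shows "scaleQ r x \<in> family_cone I f"
proof -
  obtain c where "\<forall>i\<in>I. 0 \<le> c i" "x = (\<Sum>i\<in>I. scaleQ (c i) (f i))"
    using assms(1) by (elim family_coneE)
  then show ?thesis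
    using family_coneI[of I "\<lambda>i. r * c i" f] assms(2) by (simp add: scale_sum_right)
qed

lemma family_cone_sum:
  "(\<And>j. j \<in> J \<Longrightarrow> g j \<in> family_cone I f) \<Longrightarrow> sum g J \<in> family_cone I f"
  by (induction J rule: infinite_finite_induct) (auto intro: family_cone_zero family_cone_add)

lemma family_cone_generator:
  assumes "finite I" "i \<in> I"
  shows "f i \<in> family_cone I f"
proof -
  have "(\<Sum>j\<in>I. scaleQ (if j = i then 1 else 0) (f j)) = (\<Sum>j\<in>I. if j = i then f j else 0)"
    by (intro sum.cong) auto
  also have "\<dots> = f i"
    using assms by simp
  finally show ?thesis
    using family_coneI[of I "\<lambda>j. if j = i then 1 else 0" f] by simp
qed

lemma family_cone_least:
  assumes "\<And>i. i \<in> I \<Longrightarrow> f i \<in> family_cone J g"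
  shows "family_cone I f \<subseteq> family_cone J g"
  using assms by (fastforce elim!: family_coneE intro!: family_cone_sum family_cone_scale)

lemma family_cone_insert:
  assumes "finite I" "x \<in> family_cone (insert s I) f"
  obtains b y where "0 \<le> b" "y \<in> family_cone I f" "x = scaleQ b (f s) + y"
proof (cases "s \<in> I")
  case True
  then show ?thesis
    using that[of 0 x] assms by (simp add: insert_absorb)
next
  case False
  obtain c where "\<forall>i\<in>insert s I. 0 \<le> c i" "x = (\<Sum>i\<in>insert s I. scaleQ (c i) (f i))"
    using assms(2) by (elim family_coneE)
  then show ?thesis
    using that[of "c s" "\<Sum>i\<in>I. scaleQ (c i) (f i)"] False assms(1) family_coneI[of I c f] by simp
qed

lemma family_cone_insertI:
  assumes "finite I" "0 \<le> b" "y \<in> family_cone I f"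
  shows "scaleQ b (f s) + y \<in> family_cone (insert s I) f"
proof -
  have "family_cone I f \<subseteq> family_cone (insert s I) f"
    using assms(1) by (intro family_cone_least family_cone_generator) auto
  moreover have "f s \<in> family_cone (insert s I) f"
    using assms(1) by (intro family_cone_generator) auto
  ultimately show ?thesis
    using assms by (auto intro: family_cone_add family_cone_scale)
qed

sublocale functional: vector_space_pair scaleQ "(*) :: rat \<Rightarrow> rat \<Rightarrow> rat"
  by unfold_locales (auto simp: algebra_simps)

lemma functional_nonneg_on_family_cone:
  assumes "Vector_Spaces.linear scaleQ (*) u" "\<And>i. i \<in> I \<Longrightarrow> 0 \<le> u (f i)" "x \<in> family_cone I f"
  shows "0 \<le> u x"
proof -
  interpret u: Vector_Spaces.linear scaleQ "(*)" u by fact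
  show ?thesis
    using assms(2,3) by (fastforce elim!: family_coneE simp: u.sum u.scale intro!: sum_nonneg)
qed

lemma nonzero_functional:
  assumes "v \<noteq> 0"
  shows "\<exists>u. Vector_Spaces.linear scaleQ (*) u \<and> u v < 0"
proof -
  have "independent {v}"
    using assms by simp
  then show ?thesis
    by (intro exI[of _ "functional.construct {v} (\<lambda>_. -1)"])
      (simp add: functional.linear_construct functional.construct_basis)
qed

text \<open>Induction on the number of generators, as in Fourier-Motzkin elimination. A functional \<open>u\<close>
  that separates \<open>v\<close> from all generators but \<open>f s\<close> works unless \<open>u (f s) < 0\<close>. In that case
  project along \<open>f s\<close> onto the kernel of \<open>u\<close> and separate the images. Pulling the result back makes
  it vanish on \<open>f s\<close>. If the image of \<open>v\<close> were in the cone of the images, lifting this combination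
  would put \<open>v\<close> into the original cone: the coefficient of \<open>f s\<close> that arises is nonnegative, by
  the signs of \<open>u\<close>.\<close>

lemma farkas:
  assumes "finite I" "v \<notin> family_cone I f"
  shows "\<exists>u. Vector_Spaces.linear scaleQ (*) u \<and> (\<forall>i\<in>I. 0 \<le> u (f i)) \<and> u v < 0"
  using assms
proof (induction I arbitrary: f v)
  case empty
  then have "v \<noteq> 0"
    using family_cone_zero by metis
  then show ?case
    using nonzero_functional by auto
next
  case (insert s I)
  have "v \<notin> family_cone I f"
    using family_cone_insertI[OF insert.hyps(1), of 0 v f s] insert.prems by auto
  then obtain u where u: "Vector_Spaces.linear scaleQ (*) u" "\<forall>i\<in>I. 0 \<le> u (f i)" "u v < 0"
    using insert.IH by blast
  interpret u: Vector_Spaces.linear scaleQ "(*)" u by fact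
  show ?case
  proof (cases "0 \<le> u (f s)")
    case True
    then show ?thesis using u by auto
  next
    case False
    then have neg: "u (f s) < 0" by simp
    define \<pi> where "\<pi> x = x - scaleQ (u x / u (f s)) (f s)" for x
    have \<pi>_s: "\<pi> (f s) = 0"
      using neg by (simp add: \<pi>_def)
    have "\<pi> v \<notin> family_cone I (\<lambda>i. \<pi> (f i))"
    proof
      assume "\<pi> v \<in> family_cone I (\<lambda>i. \<pi> (f i))"
      then obtain c where c: "\<forall>i\<in>I. 0 \<le> c i" "\<pi> v = (\<Sum>i\<in>I. scaleQ (c i) (\<pi> (f i)))"
        by (elim family_coneE)
      \<comment> \<open>The coefficient of \<open>f s\<close> after lifting the combination \<open>c\<close>.\<close>
      define b where "b = u v / u (f s) - (\<Sum>i\<in>I. c i * (u (f i) / u (f s)))"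
      have "0 \<le> u v / u (f s)"
        using neg u(3) by (simp add: divide_nonpos_neg)
      moreover have "(\<Sum>i\<in>I. c i * (u (f i) / u (f s))) \<le> 0"
        using neg u(2) c(1) by (intro sum_nonpos mult_nonneg_nonpos) (auto simp: divide_nonneg_neg)
      ultimately have "0 \<le> b"
        by (simp add: b_def)
      have "v = scaleQ (u v / u (f s)) (f s) + \<pi> v"
        by (simp add: \<pi>_def)
      also have "\<pi> v = (\<Sum>i\<in>I. scaleQ (c i) (f i))
          - scaleQ (\<Sum>i\<in>I. c i * (u (f i) / u (f s))) (f s)"
        unfolding c(2) by (simp add: \<pi>_def scale_right_diff_distrib sum_subtractf scale_sum_left)
      finally have "v = scaleQ b (f s) + (\<Sum>i\<in>I. scaleQ (c i) (f i))"
        by (simp add: b_def scale_left_diff_distrib add_diff_eq diff_add_eq)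
      then show False
        using insert.prems family_cone_insertI[OF insert.hyps(1) \<open>0 \<le> b\<close> family_coneI[OF c(1)]]
        by metis
    qed
    then obtain w where w: "Vector_Spaces.linear scaleQ (*) w"
      "\<forall>i\<in>I. 0 \<le> w (\<pi> (f i))" "w (\<pi> v) < 0"
      using insert.IH by blast
    interpret w: Vector_Spaces.linear scaleQ "(*)" w by fact
    have "\<pi> (x + y) = \<pi> x + \<pi> y" "\<pi> (scaleQ r x) = scaleQ r (\<pi> x)" for x y r
      by (simp_all add: \<pi>_def u.add u.scale add_divide_distrib scale_left_distrib
          scale_right_diff_distrib)
    then have "Vector_Spaces.linear scaleQ (*) (\<lambda>x. w (\<pi> x))"
      using w(1) by (simp add: Vector_Spaces.linear_iff)
    then show ?thesis
      using w \<pi>_s by (intro exI[of _ "\<lambda>x. w (\<pi> x)"]) auto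
  qed
qed

text \<open>A generating set of least cardinality is irredundant.\<close>

lemma irredundant_generators:
  assumes "polyhedral_cone scaleQ \<sigma>"
  obtains S where "finite S" "\<sigma> = cone_hull scaleQ S" "\<And>s. s \<in> S \<Longrightarrow> s \<notin> cone_hull scaleQ (S - {s})"
proof -
  let ?gen = "\<lambda>S. finite S \<and> \<sigma> = cone_hull scaleQ S"
  obtain S\<^sub>0 where "?gen S\<^sub>0"
    using assms by (auto simp: polyhedral_cone_def)
  then obtain S where S: "?gen S" and min: "\<And>T. ?gen T \<Longrightarrow> card S \<le> card T"
    using ex_has_least_nat[of ?gen S\<^sub>0 card] by metis
  have "s \<notin> cone_hull scaleQ (S - {s})" if "s \<in> S" for s
  proof
    assume redundant: "s \<in> cone_hull scaleQ (S - {s})"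
    have "cone_hull scaleQ S = cone_hull scaleQ (S - {s})"
      unfolding cone_hull_eq_family_cone
    proof (intro equalityI family_cone_least)
      show "t \<in> family_cone (S - {s}) (\<lambda>v. v)" if "t \<in> S" for t
        using redundant S that family_cone_generator[of "S - {s}" t "\<lambda>v. v"]
        by (cases "t = s") (auto simp: cone_hull_eq_family_cone)
      show "t \<in> family_cone S (\<lambda>v. v)" if "t \<in> S - {s}" for t
        using S that family_cone_generator[of S t "\<lambda>v. v"] by auto
    qed
    then have "card S \<le> card (S - {s})"
      using S by (intro min) auto
    then show False
      using S that card_Diff1_less[of S s] by simp
  qed
  then show ?thesis
    using that S by blast
qed

text \<open>For each other generator \<open>t\<close>, the vector \<open>- t\<close> is not in the cone generated by \<open>S\<close> and
  \<open>- s\<close>: otherwise some multiple of \<open>s\<close> would equal \<open>t\<close> plus a combination of \<open>S - {s}\<close>,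
  which contradicts irredundance if the multiple is positive, and strong convexity if not.
  So the Farkas lemma yields a functional that is nonnegative on \<open>S\<close>, zero at \<open>s\<close> and positive at
  \<open>t\<close>. The sum of these functionals over all \<open>t\<close> exposes the ray of \<open>s\<close>.\<close>

lemma generator_spans_face:
  assumes "finite S" and convex: "strongly_convex (cone_hull scaleQ S)"
    and irred: "\<And>s. s \<in> S \<Longrightarrow> s \<notin> cone_hull scaleQ (S - {s})" and "s \<in> S"
  shows "cone_face scaleQ (cone_hull scaleQ {s}) (cone_hull scaleQ S)"
proof -
  let ?C = "\<lambda>T. family_cone T (\<lambda>v. v)"
  have pointed: "x = 0" if "x \<in> ?C S" "- x \<in> ?C S" for x
  proof -
    have "x \<in> ?C S \<inter> uminus ` ?C S"
      using that by (auto intro: rev_image_eqI)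
    then show ?thesis
      using convex by (auto simp: strongly_convex_def cone_hull_eq_family_cone)
  qed
  have in_C: "t \<in> ?C S" if "t \<in> S" for t
    using family_cone_generator[OF \<open>finite S\<close> that, of "\<lambda>v. v"] by simp
  have sub: "?C (S - {s}) \<subseteq> ?C S"
    using in_C by (intro family_cone_least) auto
  \<comment> \<open>A functional nonnegative on both \<open>s\<close> and \<open>- s\<close> vanishes at \<open>s\<close>; this is why \<open>- s\<close> is added
    as a generator.\<close>
  have sep: "\<exists>u. Vector_Spaces.linear scaleQ (*) u \<and> (\<forall>r\<in>S. 0 \<le> u r) \<and> u s = 0 \<and> 0 < u t"
    if t: "t \<in> S - {s}" for t
  proof -
    have "t \<noteq> 0"
      using irred[of t] t family_cone_zero[of "S - {t}" "\<lambda>v. v"]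
      by (auto simp: cone_hull_eq_family_cone)
    have "- t \<notin> ?C (insert (- s) S)"
    proof
      assume "- t \<in> ?C (insert (- s) S)"
      then obtain b y where y: "0 \<le> b" "y \<in> ?C S" "- t = scaleQ b (- s) + y"
        using family_cone_insert[OF \<open>finite S\<close>, of "- t" "- s" "\<lambda>v. v"] by metis
      have "y \<in> ?C (insert s (S - {s}))"
        using y(2) \<open>s \<in> S\<close> by (simp add: insert_absorb)
      then obtain a z where z: "0 \<le> a" "z \<in> ?C (S - {s})" "y = scaleQ a s + z"
        using family_cone_insert[of "S - {s}" y s "\<lambda>v. v"] \<open>finite S\<close> by auto
      define x where "x = t + z"
      have x: "x \<in> ?C (S - {s})"
        unfolding x_def using family_cone_generator[of "S - {s}" t "\<lambda>v. v"] \<open>finite S\<close> t z(2)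
        by (intro family_cone_add) auto
      have eq: "scaleQ (b - a) s = x"
        using y(3) z(3) by (simp add: x_def algebra_simps)
      show False
      proof (cases "a < b")
        case True
        have "scaleQ (1 / (b - a)) (scaleQ (b - a) s) = s"
          using True by simp
        then have "s \<in> ?C (S - {s})"
          using family_cone_scale[OF x, of "1 / (b - a)"] True eq by simp
        then show False
          using irred[OF \<open>s \<in> S\<close>] by (simp add: cone_hull_eq_family_cone)
      next
        case False
        have "- x = scaleQ (a - b) s"
          using eq by (simp add: scale_left_diff_distrib algebra_simps flip: eq)
        then have "- x \<in> ?C S"
          using False in_C[OF \<open>s \<in> S\<close>] by (simp add: family_cone_scale)
        then have "x = 0"
          using x sub by (intro pointed) auto
        then have "- t \<in> ?C S"
          using z(2) sub by (auto simp: x_def add_eq_0_iff)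
        then show False
          using pointed[of t] in_C t \<open>t \<noteq> 0\<close> by auto
      qed
    qed
    then obtain u where u: "Vector_Spaces.linear scaleQ (*) u"
      "\<forall>r\<in>insert (- s) S. 0 \<le> u r" "u (- t) < 0"
      using farkas[of "insert (- s) S" "- t" "\<lambda>v. v"] \<open>finite S\<close> by auto
    interpret u: Vector_Spaces.linear scaleQ "(*)" u by fact
    have "u s = 0"
      using u(2) \<open>s \<in> S\<close> u.neg[of s] by force
    then show ?thesis
      using u u.neg[of t] by (intro exI[of _ u]) auto
  qed
  then obtain U where U: "\<And>t. t \<in> S - {s} \<Longrightarrow> Vector_Spaces.linear scaleQ (*) (U t)"
    "\<And>t r. t \<in> S - {s} \<Longrightarrow> r \<in> S \<Longrightarrow> 0 \<le> U t r"
    "\<And>t. t \<in> S - {s} \<Longrightarrow> U t s = 0" "\<And>t. t \<in> S - {s} \<Longrightarrow> 0 < U t t"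
    by metis
  define u where "u x = (\<Sum>t\<in>S - {s}. U t x)" for x
  have lin: "Vector_Spaces.linear scaleQ (*) u"
    unfolding u_def using U(1) by (intro functional.linear_compose_sum) auto
  interpret u: Vector_Spaces.linear scaleQ "(*)" u by fact
  have u_s: "u s = 0"
    using U(3) by (simp add: u_def)
  have u_pos: "0 < u t" if "t \<in> S - {s}" for t
    unfolding u_def using U(2)[of _ t] U(4)[OF that] \<open>finite S\<close> that by (intro sum_pos2[of _ t]) auto
  have nonneg: "0 \<le> u t" if "t \<in> S" for t
    using that u_s u_pos[of t] by (cases "t = s") auto
  have "cone_hull scaleQ {s} = {x \<in> cone_hull scaleQ S. u x = 0}"
  proof (intro equalityI subsetI)
    fix x assume "x \<in> cone_hull scaleQ {s}"
    then obtain c where "0 \<le> c" "x = scaleQ c s"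
      by (auto simp: cone_hull_def)
    then show "x \<in> {x \<in> cone_hull scaleQ S. u x = 0}"
      using u_s in_C[OF \<open>s \<in> S\<close>] by (auto simp: cone_hull_eq_family_cone u.scale family_cone_scale)
  next
    fix x assume "x \<in> {x \<in> cone_hull scaleQ S. u x = 0}"
    then obtain c where c: "\<forall>t\<in>S. 0 \<le> c t" "x = (\<Sum>t\<in>S. scaleQ (c t) t)" and "u x = 0"
      by (auto simp: cone_hull_def)
    then have "(\<Sum>t\<in>S. c t * u t) = 0"
      by (simp add: u.sum u.scale)
    then have "\<forall>t\<in>S. c t * u t = 0"
      using c(1) nonneg \<open>finite S\<close> by (subst (asm) sum_nonneg_eq_0_iff) auto
    then have "c t = 0" if "t \<in> S - {s}" for t
      using u_pos[OF that] that by auto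
    then have "x = scaleQ (c s) s"
      using c(2) \<open>s \<in> S\<close> \<open>finite S\<close> by (simp add: sum.remove[of S s])
    then show "x \<in> cone_hull scaleQ {s}"
      using c(1) \<open>s \<in> S\<close> by (auto simp: cone_hull_def intro!: exI[of _ c])
  qed
  moreover have "0 \<le> u x" if "x \<in> cone_hull scaleQ S" for x
    using functional_nonneg_on_family_cone[OF lin, of S "\<lambda>v. v" x] nonneg that
    by (simp add: cone_hull_eq_family_cone)
  ultimately show ?thesis
    unfolding cone_face_def using lin by blast
qed

text \<open>A vector lies in some cone of the fan. Irredundant generators of that cone span faces, which
  belong to the fan and are one-dimensional, so each generator is a multiple of a ray generator.\<close>

lemma complete_fan_generated_by_rays:
  assumes "complete_fan scaleQ \<Sigma>" and rays: "rays scaleQ \<Sigma> \<subseteq> (\<lambda>i. cone_hull scaleQ {f i}) ` I"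
    and "finite I"
  shows "v \<in> family_cone I f"
proof -
  have fan: "fan scaleQ \<Sigma>" and "\<Union>\<Sigma> = UNIV"
    using assms(1) by (auto simp: complete_fan_def)
  then obtain \<sigma> where \<sigma>: "\<sigma> \<in> \<Sigma>" "v \<in> \<sigma>"
    by blast
  then obtain S where S: "finite S" "\<sigma> = cone_hull scaleQ S"
    and irred: "\<And>s. s \<in> S \<Longrightarrow> s \<notin> cone_hull scaleQ (S - {s})"
    using fan irredundant_generators[of \<sigma>] unfolding fan_def by blast
  have "s \<in> family_cone I f" if "s \<in> S" for s
  proof -
    let ?\<rho> = "cone_hull scaleQ {s}"
    have "cone_face scaleQ ?\<rho> \<sigma>"
      using generator_spans_face[OF S(1) _ irred that] fan \<sigma>(1) S(2) unfolding fan_def by blast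
    then have "?\<rho> \<in> \<Sigma>"
      using fan \<sigma>(1) unfolding fan_def by blast
    have "s \<noteq> 0"
      using irred[OF that] family_cone_zero[of "S - {s}" "\<lambda>v. v"]
      by (auto simp: cone_hull_eq_family_cone)
    have s: "s \<in> ?\<rho>"
      using family_cone_generator[of "{s}" s "\<lambda>v. v"] by (simp add: cone_hull_eq_family_cone)
    have "?\<rho> \<subseteq> span {s}"
      by (auto simp: cone_hull_def span_base span_scale)
    then have "dim ?\<rho> = 1"
      using s \<open>s \<noteq> 0\<close> by (intro dim_unique[of "{s}"]) auto
    then have "?\<rho> \<in> rays scaleQ \<Sigma>"
      using \<open>?\<rho> \<in> \<Sigma>\<close> by (simp add: rays_def)
    then obtain i where "i \<in> I" "?\<rho> = cone_hull scaleQ {f i}"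
      using rays by blast
    then obtain c where "0 \<le> c" "s = scaleQ c (f i)"
      using s by (auto simp: cone_hull_def)
    then show ?thesis
      using family_cone_scale[OF family_cone_generator[OF \<open>finite I\<close> \<open>i \<in> I\<close>]] by simp
  qed
  then have "family_cone S (\<lambda>v. v) \<subseteq> family_cone I f"
    by (intro family_cone_least)
  then show ?thesis
    using \<sigma>(2) S(2) by (auto simp: cone_hull_eq_family_cone)
qed

end

section \<open>Functionals on the lattice\<close>

lemma common_denominator:
  fixes c :: "'i \<Rightarrow> rat"
  assumes "finite I"
  shows "\<exists>d::int. 0 < d \<and> (\<forall>i\<in>I. of_int d * c i \<in> \<int>)"
  using assms
proof induction
  case empty
  show ?case by (intro exI[of _ 1]) auto
next
  case (insert j I)
  then obtain d :: int where d: "0 < d" "\<forall>i\<in>I. of_int d * c i \<in> \<int>"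
    by blast
  obtain a b where ab: "c j = of_int a / of_int b" "0 < b"
    by (cases "c j") (auto simp: Fract_of_int_quotient)
  have "of_int (b * d) * c i \<in> \<int>" if "i \<in> insert j I" for i
  proof (cases "i = j")
    case True
    then have "of_int (b * d) * c i = of_int (d * a)"
      using ab by simp
    then show ?thesis
      by (metis Ints_of_int)
  next
    case False
    then have "of_int d * c i \<in> \<int>"
      using d(2) that by blast
    then have "of_int b * (of_int d * c i) \<in> \<int>"
      by (rule Ints_mult[OF Ints_of_int])
    then show ?thesis
      by (simp only: of_int_mult mult.assoc)
  qed
  then show ?case
    using d(1) ab(2) by (intro exI[of _ "b * d"]) auto
qed

context rational_lattice
begin

sublocale V: rational_vector_space scaleQ ..

lemma emb_scale: "emb (scaleZ k x) = scaleQ (of_int k) (emb x)"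
proof -
  interpret emb: additive emb
    by standard (rule emb_add)
  show ?thesis
    by (induction k rule: int_induct[of _ 0])
      (simp_all add: emb.zero emb_add emb.diff scale_left_distrib scale_left_diff_distrib
        V.scale_left_distrib V.scale_left_diff_distrib)
qed

lemma emb_sum: "emb (sum g J) = (\<Sum>j\<in>J. emb (g j))"
proof -
  interpret emb: additive emb
    by standard (rule emb_add)
  show ?thesis by (rule emb.sum)
qed

text \<open>Clearing denominators brings a rational combination back into the lattice, so functionals on
  the lattice need not be extended to the rational vector space.\<close>

lemma positive_multiple_integral:
  assumes "emb x \<in> V.family_cone I (\<lambda>i. emb (f i))" "finite I"
  obtains d c where "0 < d" "\<And>i. i \<in> I \<Longrightarrow> 0 \<le> c i" "scaleZ d x = (\<Sum>i\<in>I. scaleZ (c i) (f i))"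
proof -
  obtain r where r: "\<forall>i\<in>I. 0 \<le> r i" "emb x = (\<Sum>i\<in>I. scaleQ (r i) (emb (f i)))"
    using assms(1) by (elim V.family_coneE)
  obtain d :: int where d: "0 < d" "\<forall>i\<in>I. of_int d * r i \<in> \<int>"
    using common_denominator[OF assms(2)] by blast
  define c where "c i = \<lfloor>of_int d * r i\<rfloor>" for i
  have c: "of_int (c i) = of_int d * r i" if "i \<in> I" for i
    using d(2) that by (auto simp: c_def elim: Ints_cases)
  have "emb (scaleZ d x) = emb (\<Sum>i\<in>I. scaleZ (c i) (f i))"
    by (simp add: emb_scale emb_sum r(2) V.scale_sum_right c)
  then have "scaleZ d x = (\<Sum>i\<in>I. scaleZ (c i) (f i))"
    using emb_inj by (simp add: inj_eq)
  moreover have "0 \<le> c i" if "i \<in> I" for i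
    using d(1) r(1) that by (simp add: c_def)
  ultimately show ?thesis
    using that d(1) by blast
qed

text \<open>Since every vector is a nonnegative combination of ray generators, \<open>e\<close> is nonnegative at both
  \<open>x\<close> and \<open>- x\<close>.\<close>

lemma functional_nonneg_on_rays_eq_0:
  assumes fan: "complete_fan scaleQ \<Sigma>" and gen: "ray_generators scaleZ scaleQ emb \<Sigma> m p"
    and e: "e \<in> dual_lattice scaleZ" and nonneg: "\<And>i. i \<in> {1..m} \<Longrightarrow> 0 \<le> e (p i)"
  shows "e x = 0"
proof -
  interpret e: module_hom scaleZ "(*)" e
    using e by (simp add: dual_lattice_def)
  have "0 \<le> e y" for y
  proof -
    have "emb y \<in> V.family_cone {1..m} (\<lambda>i. emb (p i))"
      using gen by (intro V.complete_fan_generated_by_rays[OF fan])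
        (auto simp: ray_generators_def bij_betw_def)
    then obtain d c where dc: "0 < d" "\<And>i. i \<in> {1..m} \<Longrightarrow> 0 \<le> c i"
      "scaleZ d y = (\<Sum>i\<in>{1..m}. scaleZ (c i) (p i))"
      by (rule positive_multiple_integral) auto
    have "d * e y = (\<Sum>i\<in>{1..m}. c i * e (p i))"
      using arg_cong[OF dc(3), of e] by (simp add: e.scale e.sum)
    also have "\<dots> \<ge> 0"
      using dc(2) nonneg by (intro sum_nonneg mult_nonneg_nonneg) auto
    finally show ?thesis
      using dc(1) by (simp add: zero_le_mult_iff)
  qed
  from this[of x] this[of "- x"] show ?thesis
    by (simp add: e.neg)
qed

end
section \<open>Roots of bilateral fans\<close>

locale bilateral = rational_lattice +
  fixes \<Sigma> m p a q
  assumes bilateral: "bilateral_fan scaleZ scaleQ emb n \<Sigma> m p a"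
    and dual: "dual_basis scaleZ n p q"
begin

lemma functional_ext:
  assumes "e \<in> dual_lattice scaleZ" "f \<in> dual_lattice scaleZ" "\<And>j. j \<in> {1..n} \<Longrightarrow> e (p j) = f (p j)"
  shows "e = f"
proof
  fix x
  interpret e: module_hom scaleZ "(*)" e
    using assms(1) by (simp add: dual_lattice_def)
  interpret module_pair scaleZ "(*) :: int \<Rightarrow> int \<Rightarrow> int" ..
  have "x \<in> span (p ` {1..n})"
    using bilateral by (simp add: bilateral_fan_def lattice_basis_def)
  then show "e x = f x"
    using assms by (intro module_hom_eq_on_span[of e f "p ` {1..n}" x]) (auto simp: dual_lattice_def)
qed

lemma dual_basis_mem: "i \<in> {1..n} \<Longrightarrow> q i \<in> dual_lattice scaleZ"
  using dual by (simp add: dual_basis_def)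

lemma dual_basis_eval: "i \<in> {1..n} \<Longrightarrow> j \<in> {1..n} \<Longrightarrow> q i (p j) = (if i = j then 1 else 0)"
  using dual by (simp add: dual_basis_def)

lemma combination_mem_dual_lattice:
  assumes "J \<subseteq> {1..n}"
  shows "(\<lambda>x. \<Sum>j\<in>J. c j * q j x) \<in> dual_lattice scaleZ"
proof -
  interpret module_pair scaleZ "(*) :: int \<Rightarrow> int \<Rightarrow> int"
    by unfold_locales (auto simp: algebra_simps)
  show ?thesis
    using assms dual_basis_mem unfolding dual_lattice_def
    by (auto intro!: module_hom_sum module_hom_scale simp: module_axioms m2.module_axioms)
qed

lemma combination_eval:
  assumes "J \<subseteq> {1..n}" "i \<in> {1..n}"
  shows "(\<Sum>j\<in>J. c j * q j (p i)) = (if i \<in> J then c i else 0)"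
proof -
  have "(\<Sum>j\<in>J. c j * q j (p i)) = (\<Sum>j\<in>J. if i = j then c j else 0)"
    using assms by (intro sum.cong) (auto simp: dual_basis_eval)
  also have "\<dots> = (if i \<in> J then c i else 0)"
    using finite_subset[OF assms(1)] by simp
  finally show ?thesis .
qed

lemma dual_coords_eq:
  assumes e: "e \<in> dual_lattice scaleZ"
  shows "dual_coords n q e = vec n (\<lambda>r. e (p (r + 1)))"
  unfolding dual_coords_def
proof (rule the_equality, intro conjI)
  show "vec n (\<lambda>r. e (p (r + 1))) \<in> carrier_vec n"
    by simp
  show "e = (\<lambda>x. \<Sum>j\<in>{1..n}. vec n (\<lambda>r. e (p (r + 1))) $ (j - 1) * q j x)"
    using e by (intro functional_ext combination_mem_dual_lattice) (auto simp: combination_eval)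
next
  fix c assume c: "c \<in> carrier_vec n \<and> e = (\<lambda>x. \<Sum>j\<in>{1..n}. c $ (j - 1) * q j x)"
  show "c = vec n (\<lambda>r. e (p (r + 1)))"
  proof (rule eq_vecI)
    fix r assume "r < dim_vec (vec n (\<lambda>r. e (p (r + 1))))"
    then have "r < n" by simp
    have "e (p (r + 1)) = (\<Sum>j\<in>{1..n}. c $ (j - 1) * q j (p (r + 1)))"
      using c by (auto dest: fun_cong)
    also have "\<dots> = c $ r"
      using \<open>r < n\<close> by (subst combination_eval) auto
    finally show "c $ r = vec n (\<lambda>r. e (p (r + 1))) $ r"
      using \<open>r < n\<close> by simp
  qed (use c in auto)
qed

lemma coeff_nonneg: "k \<in> {n+1..m} \<Longrightarrow> j \<in> {1..n} \<Longrightarrow> 0 \<le> a k j"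
  using bilateral by (simp add: bilateral_fan_def)

lemma eval_ray:
  assumes "e \<in> dual_lattice scaleZ" "k \<in> {n+1..m}"
  shows "e (p k) = - (\<Sum>j\<in>{1..n}. a k j * e (p j))"
proof -
  interpret e: module_hom scaleZ "(*)" e
    using assms(1) by (simp add: dual_lattice_def)
  have "p k = - (\<Sum>j\<in>{1..n}. scaleZ (a k j) (p j))"
    using bilateral assms(2) by (simp add: bilateral_fan_def)
  then show ?thesis
    by (simp add: e.neg e.sum e.scale)
qed

lemma ray_matrix_mult_dual_coords:
  assumes "e \<in> dual_lattice scaleZ"
  shows "- (ray_matrix n m a *\<^sub>v dual_coords n q e) = vec (m - n) (\<lambda>r. e (p (n + 1 + r)))"
proof (rule eq_vecI)
  fix r assume "r < dim_vec (vec (m - n) (\<lambda>r. e (p (n + 1 + r))))"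
  then have r: "r < m - n" by simp
  have "(\<Sum>c<n. a (n + 1 + r) (Suc c) * e (p (Suc c))) = (\<Sum>j\<in>{1..n}. a (n + 1 + r) j * e (p j))"
    by (simp add: sum.atLeast1_atMost_eq)
  also have "\<dots> = - e (p (n + 1 + r))"
    using eval_ray[OF assms, of "n + 1 + r"] r by simp
  finally show "(- (ray_matrix n m a *\<^sub>v dual_coords n q e)) $ r = vec (m - n) (\<lambda>r. e (p (n + 1 + r))) $ r"
    using r by (simp add: dual_coords_eq[OF assms] ray_matrix_def scalar_prod_def lessThan_atLeast0)
qed (simp add: ray_matrix_def)

text \<open>The link between the matrix inequality and roots: \<open>- A e\<close> lists the values of \<open>e\<close> on the
  rays outside the basis.\<close>

lemma ray_matrix_nonneg_iff:
  assumes "e \<in> dual_lattice scaleZ"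
  shows "0\<^sub>v (m - n) \<le> - (ray_matrix n m a *\<^sub>v dual_coords n q e) \<longleftrightarrow> (\<forall>k\<in>{n+1..m}. 0 \<le> e (p k))"
proof -
  have "(\<forall>r<m - n. 0 \<le> e (p (n + 1 + r))) \<longleftrightarrow> (\<forall>k\<in>{n+1..m}. 0 \<le> e (p k))"
  proof safe
    fix k assume "\<forall>r<m - n. 0 \<le> e (p (n + 1 + r))" "k \<in> {n+1..m}"
    then show "0 \<le> e (p k)"
      by (auto dest: spec[of _ "k - n - 1"])
  qed auto
  then show ?thesis
    by (simp add: ray_matrix_mult_dual_coords[OF assms] less_eq_vec_def)
qed

lemma attached_root_iff:
  assumes i: "i \<in> {1..n}" and b: "\<And>j. j \<in> {1..n} - {i} \<Longrightarrow> 0 \<le> b j"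
    and e_def: "e = (\<lambda>x. - q i x + (\<Sum>j\<in>{1..n} - {i}. b j * q j x))"
  shows "e \<in> demazure_roots scaleZ m p i \<longleftrightarrow>
    0\<^sub>v (m - n) \<le> - (ray_matrix n m a *\<^sub>v dual_coords n q e)"
proof -
  have "e = (\<lambda>x. \<Sum>j\<in>{1..n}. (if j = i then -1 else b j) * q j x)"
    using i by (simp add: e_def sum.remove)
  then have e: "e \<in> dual_lattice scaleZ"
    by (simp add: combination_mem_dual_lattice)
  have "e (p s) = (if s = i then -1 else b s)" if "s \<in> {1..n}" for s
    using that i combination_eval[of "{1..n} - {i}" s b] by (auto simp: e_def dual_basis_eval[OF i])
  moreover have "{1..m} - {i} = ({1..n} - {i}) \<union> {n+1..m}"
    using i bilateral by (auto simp: bilateral_fan_def)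
  ultimately have "e \<in> demazure_roots scaleZ m p i \<longleftrightarrow> (\<forall>k\<in>{n+1..m}. 0 \<le> e (p k))"
    using e i b by (auto simp: demazure_roots_def)
  then show ?thesis
    by (simp add: ray_matrix_nonneg_iff[OF e])
qed

text \<open>If column \<open>j\<close> vanished, then the nonzero functional \<open>q j\<close> would be nonnegative on all rays,
  contradicting completeness.\<close>

lemma column_nonzero:
  assumes "j \<in> {1..n}"
  shows "\<exists>s\<in>{n+1..m}. a s j \<noteq> 0"
proof (rule ccontr)
  assume zero: "\<not> (\<exists>s\<in>{n+1..m}. a s j \<noteq> 0)"
  have "0 \<le> q j (p i)" if i: "i \<in> {1..m}" for i
  proof (cases "i \<le> n")
    case True
    then show ?thesis
      using i assms by (simp add: dual_basis_eval)
  next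
    case False
    then have "i \<in> {n+1..m}"
      using i by simp
    then have "q j (p i) = - (\<Sum>l\<in>{1..n}. a i l * q j (p l))"
      using assms by (intro eval_ray dual_basis_mem)
    also have "(\<Sum>l\<in>{1..n}. a i l * q j (p l)) = 0"
      using assms zero \<open>i \<in> {n+1..m}\<close> by (intro sum.neutral) (auto simp: dual_basis_eval)
    finally show ?thesis by simp
  qed
  then have "q j (p j) = 0"
    using bilateral assms unfolding bilateral_fan_def
    by (intro functional_nonneg_on_rays_eq_0 dual_basis_mem) auto
  then show False
    using assms by (simp add: dual_basis_eval)
qed

lemma column_eq_unit_vec_iff:
  assumes "k \<in> {n+1..m}" "i \<in> {1..n}"
  shows "col (ray_matrix n m a) (i - 1) = unit_vec (m - n) (k - n - 1) \<longleftrightarrow>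
    (\<forall>s\<in>{n+1..m}. a s i = (if s = k then 1 else 0))" (is "?col \<longleftrightarrow> ?entries")
proof -
  have "?col \<longleftrightarrow> (\<forall>r<m - n. a (n + 1 + r) i = (if r = k - n - 1 then 1 else 0))"
    using assms by (auto simp: vec_eq_iff ray_matrix_def)
  also have "\<dots> \<longleftrightarrow> ?entries"
  proof (intro iffI ballI allI impI)
    fix s assume "\<forall>r<m - n. a (n + 1 + r) i = (if r = k - n - 1 then 1 else 0)" "s \<in> {n+1..m}"
    then show "a s i = (if s = k then 1 else 0)"
      using assms(1) by (auto dest!: spec[of _ "s - n - 1"])
  next
    fix r assume "?entries" "r < m - n"
    then show "a (n + 1 + r) i = (if r = k - n - 1 then 1 else 0)"
      using assms(1) by auto
  qed
  finally show ?thesis .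
qed

text \<open>The values \<open>e (p j)\<close> on the basis are nonnegative. On the rays outside the basis \<open>e\<close> is
  minus a sum of nonnegative integers, and this sum is 1 on ray \<open>k\<close> and at most 0 on the others.\<close>

lemma detached_root_iff:
  assumes k: "k \<in> {n+1..m}" and e: "e \<in> dual_lattice scaleZ"
  shows "e \<in> demazure_roots scaleZ m p k \<longleftrightarrow>
    (\<exists>i\<in>{1..n}. e = q i \<and> (\<forall>s\<in>{n+1..m}. a s i = (if s = k then 1 else 0)))"
proof
  assume "e \<in> demazure_roots scaleZ m p k"
  then have e_k: "e (p k) = -1" and e_s: "\<And>s. s \<in> {1..m} \<Longrightarrow> s \<noteq> k \<Longrightarrow> 0 \<le> e (p s)"
    by (auto simp: demazure_roots_def)
  have nonneg: "0 \<le> e (p j)" if "j \<in> {1..n}" for j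
    using that k by (intro e_s) auto
  have sum_k: "(\<Sum>j\<in>{1..n}. a k j * e (p j)) = 1"
    using eval_ray[OF e k] e_k by simp
  have vanish: "a s j * e (p j) = 0" if "s \<in> {n+1..m}" "s \<noteq> k" "j \<in> {1..n}" for s j
  proof -
    have "0 \<le> e (p s)"
      using that by (intro e_s) auto
    then have "(\<Sum>j\<in>{1..n}. a s j * e (p j)) \<le> 0"
      using eval_ray[OF e that(1)] by simp
    moreover have "\<forall>j\<in>{1..n}. 0 \<le> a s j * e (p j)"
      using nonneg coeff_nonneg[OF that(1)] by simp
    ultimately have "\<forall>j\<in>{1..n}. a s j * e (p j) = 0"
      by (metis (no_types, lifting) finite_atLeastAtMost order_antisym sum_nonneg sum_nonneg_eq_0_iff)
    then show ?thesis
      using that(3) by blast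
  qed
  obtain i where i: "i \<in> {1..n}" "a k i * e (p i) \<noteq> 0"
    using sum_k by (metis (no_types, lifting) sum.neutral zero_neq_one)
  have split: "a k i * e (p i) + (\<Sum>j\<in>{1..n} - {i}. a k j * e (p j)) = 1"
    using sum_k i(1) by (simp add: sum.remove)
  have summand_nonneg: "0 \<le> a k j * e (p j)" if "j \<in> {1..n}" for j
    using nonneg[OF that] coeff_nonneg[OF k that] by simp
  then have rest_nonneg: "0 \<le> (\<Sum>j\<in>{1..n} - {i}. a k j * e (p j))"
    by (intro sum_nonneg) auto
  have "1 \<le> a k i * e (p i)"
    using i summand_nonneg[OF i(1)] by linarith
  then have "a k i * e (p i) = 1" and "(\<Sum>j\<in>{1..n} - {i}. a k j * e (p j)) = 0"
    using split rest_nonneg by linarith+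
  then have others: "a k j * e (p j) = 0" if "j \<in> {1..n} - {i}" for j
    using summand_nonneg that by (subst (asm) sum_nonneg_eq_0_iff) auto
  have i_1: "a k i = 1" "e (p i) = 1"
    using \<open>a k i * e (p i) = 1\<close> coeff_nonneg[OF k i(1)] by (auto simp: zmult_eq_1_iff)
  have "e (p j) = 0" if j: "j \<in> {1..n} - {i}" for j
  proof (rule ccontr)
    assume "e (p j) \<noteq> 0"
    \<comment> \<open>Every product \<open>a s j * e (p j)\<close> vanishes, for \<open>s = k\<close> as well.\<close>
    then have "a s j = 0" if "s \<in> {n+1..m}" for s
      using that vanish[of s j] others[OF j] j by (cases "s = k") auto
    then show False
      using column_nonzero[of j] j by auto
  qed
  then have "e = q i"
    using i(1) i_1 e by (intro functional_ext dual_basis_mem) (auto simp: dual_basis_eval)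
  then show "\<exists>i\<in>{1..n}. e = q i \<and> (\<forall>s\<in>{n+1..m}. a s i = (if s = k then 1 else 0))"
    using i(1) i_1 vanish[of _ i] by auto
next
  assume "\<exists>i\<in>{1..n}. e = q i \<and> (\<forall>s\<in>{n+1..m}. a s i = (if s = k then 1 else 0))"
  then obtain i where i: "i \<in> {1..n}" "e = q i"
    "\<And>s. s \<in> {n+1..m} \<Longrightarrow> a s i = (if s = k then 1 else 0)"
    by blast
  have "e (p s) = (if s = k then -1 else 0)" if "s \<in> {n+1..m}" for s
  proof -
    have "(\<Sum>j\<in>{1..n}. a s j * e (p j)) = (\<Sum>j\<in>{1..n}. if i = j then a s j else 0)"
      using i(1,2) by (intro sum.cong) (auto simp: dual_basis_eval)
    then show ?thesis
      using eval_ray[OF e that] i(1,3) that by simp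
  qed
  moreover have "0 \<le> e (p s)" if "s \<in> {1..n}" for s
    using i that by (simp add: dual_basis_eval)
  ultimately have "0 \<le> e (p s)" if "s \<in> {1..m} - {k}" for s
    using that by (cases "s \<le> n") auto
  then show "e \<in> demazure_roots scaleZ m p k"
    using e k \<open>\<And>s. s \<in> {n+1..m} \<Longrightarrow> e (p s) = (if s = k then -1 else 0)\<close>
    by (auto simp: demazure_roots_def)
qed

end

theorem proposition2p2:
  fixes scaleZ :: "int \<Rightarrow> 'a::ab_group_add \<Rightarrow> 'a"
    and scaleQ :: "rat \<Rightarrow> 'v::ab_group_add \<Rightarrow> 'v"
    and emb :: "'a \<Rightarrow> 'v"
    and n m :: nat
    and \<Sigma> :: "'v set set"
    and p :: "nat \<Rightarrow> 'a"
    and a :: "nat \<Rightarrow> nat \<Rightarrow> int"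
    and q :: "nat \<Rightarrow> 'a \<Rightarrow> int"
    and A :: "int mat"
  assumes "rational_lattice scaleZ scaleQ emb n"
    and "bilateral_fan scaleZ scaleQ emb n \<Sigma> m p a"
    and "dual_basis scaleZ n p q"
    and "A = ray_matrix n m a"
  shows "(\<forall>i\<in>{1..n}. \<forall>b :: nat \<Rightarrow> int. \<forall>e.
            (\<forall>j\<in>{1..n} - {i}. 0 \<le> b j) \<and>
            e = (\<lambda>x. - q i x + (\<Sum>j\<in>{1..n} - {i}. b j * q j x)) \<longrightarrow>
            (e \<in> demazure_roots scaleZ m p i \<longleftrightarrow>
             0\<^sub>v (m - n) \<le> - (A *\<^sub>v dual_coords n q e)))
       \<and> (\<forall>k\<in>{n+1..m}. \<forall>e\<in>dual_lattice scaleZ.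
            e \<in> demazure_roots scaleZ m p k \<longleftrightarrow>
            (\<exists>i\<in>{1..n}. e = q i \<and> col A (i - 1) = unit_vec (m - n) (k - n - 1)))"
proof -
  interpret bilateral scaleZ scaleQ emb n \<Sigma> m p a q
    using assms(1-3) by (simp add: bilateral_def bilateral_axioms_def)
  show ?thesis
    using attached_root_iff detached_root_iff column_eq_unit_vec_iff unfolding \<open>A = ray_matrix n m a\<close>
    by (intro conjI ballI allI impI) auto
qed

end
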